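(* Let $P : A \to A$ be a real completely positive completely bicontractive projection on a unital operator algebra $A$. If $A$ is an operator algebra containing no nonzero nilpotents, then $P(A)$ is a subalgebra of $A$. Also, if the closed algebra $D$ generated by $P(A)$ is semiprime, then $P(A)$ is a subalgebra of $A$.
   Context: A unital operator algebra is a norm-closed, not necessarily selfadjoint, algebra of operators on a Hilbert space containing the identity operator, with its inherited operator space structure. A projection on $A$ is a linear idempotent map $P : A \to A$; it is completely bicontractive if both $P$ and $I-P$ are completely contractive. Write $\mathfrak{r}_A = \{x \in A : x + x^* \geq 0\}$; $P$ is real completely positive if $P_n(\mathfrak{r}_{M_n(A)}) \subset \mathfrak{r}_{M_n(A)}$ for all $n \in \mathbb{N}$, where $P_n$ is the amplification to $M_n(A)$. An algebra is semiprime if it has no nontrivial square-zero ideals. *)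

theory Defs
  imports "HOL-Analysis.Analysis"
begin

text \<open>Complex Hilbert spaces. The class extends \<open>real_inner\<close>, whose inner product is required to be
  the real part of the complex one, so that the norm, the topology and the type of bounded
  operators are those of the library. The inner product is linear in the first argument.\<close>

class complex_hilbert_space = real_inner + complete_space +
  fixes scaleC :: "complex \<Rightarrow> 'a \<Rightarrow> 'a" (infixr \<open>*\<^sub>C\<close> 75)
    and cinner :: "'a \<Rightarrow> 'a \<Rightarrow> complex"
  assumes scaleC_add_right: "c *\<^sub>C (x + y) = c *\<^sub>C x + c *\<^sub>C y"
    and scaleC_add_left: "(c + d) *\<^sub>C x = c *\<^sub>C x + d *\<^sub>C x"
    and scaleC_scaleC: "c *\<^sub>C d *\<^sub>C x = (c * d) *\<^sub>C x"
    and scaleC_of_real: "complex_of_real r *\<^sub>C x = r *\<^sub>R x"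
    and cinner_add_left: "cinner (x + y) z = cinner x z + cinner y z"
    and cinner_scaleC_left: "cinner (c *\<^sub>C x) y = c * cinner x y"
    and cinner_commute: "cinner y x = cnj (cinner x y)"
    and inner_eq_Re_cinner: "inner x y = Re (cinner x y)"
begin

subclass banach ..

end

instantiation complex :: complex_hilbert_space
begin

definition scaleC_complex :: "complex \<Rightarrow> complex \<Rightarrow> complex"
  where "scaleC_complex c x = c * x"

definition cinner_complex :: "complex \<Rightarrow> complex \<Rightarrow> complex"
  where "cinner_complex x y = x * cnj y"

instance
  by standard
    (simp_all add: scaleC_complex_def cinner_complex_def algebra_simps scaleR_conv_of_real
      inner_complex_def)

end

lemma norm_scaleC: "norm (c *\<^sub>C x) = cmod c * norm (x :: 'a :: complex_hilbert_space)"
proof -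
  have "cinner (c *\<^sub>C x) (c *\<^sub>C x) = c * cnj (c * cinner x x)"
    by (metis cinner_commute cinner_scaleC_left)
  also have "\<dots> = (c * cnj c) * cinner x x"
    by (metis cinner_commute complex_cnj_mult mult.assoc)
  also have "\<dots> = complex_of_real ((cmod c)\<^sup>2) * cinner x x"
    by (simp only: complex_norm_square)
  finally have "inner (c *\<^sub>C x) (c *\<^sub>C x) = (cmod c)\<^sup>2 * inner x x"
    by (simp add: inner_eq_Re_cinner)
  then show ?thesis
    by (simp add: norm_eq_sqrt_inner real_sqrt_mult)
qed

text \<open>The library's bounded operators are only real linear; membership in \<open>complex_linear_ops\<close>
  cuts out \<open>B(H)\<close>. On \<open>B(H)\<close> the norm of \<open>blinfun\<close> is the usual operator norm.\<close>

definition complex_linear_ops :: "('h::complex_hilbert_space \<Rightarrow>\<^sub>L 'h) set"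
  where "complex_linear_ops = {T :: 'h \<Rightarrow>\<^sub>L 'h. \<forall>c x. T (c *\<^sub>C x) = c *\<^sub>C T x}"

lift_definition scaleC_op ::
  "complex \<Rightarrow> ('h::complex_hilbert_space \<Rightarrow>\<^sub>L 'h) \<Rightarrow> ('h \<Rightarrow>\<^sub>L 'h)" (infixr \<open>*\<^sub>O\<close> 75)
  is "\<lambda>c T x. c *\<^sub>C T x"
proof -
  fix c :: complex and T :: "'h \<Rightarrow> 'h"
  assume T: "bounded_linear T"
  have "bounded_linear (\<lambda>x::'h. c *\<^sub>C x)"
  proof (rule bounded_linear_intro)
    show "c *\<^sub>C (r *\<^sub>R x) = r *\<^sub>R (c *\<^sub>C x)" for r and x :: 'h
      by (simp add: scaleC_of_real[symmetric] scaleC_scaleC mult.commute)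
    show "norm (c *\<^sub>C x) \<le> norm x * cmod c" for x :: 'h
      by (simp add: norm_scaleC)
  qed (rule scaleC_add_right)
  from bounded_linear_compose[OF this T] show "bounded_linear (\<lambda>x. c *\<^sub>C T x)" .
qed

text \<open>The Hilbert space adjoint, which exists uniquely by the Riesz representation theorem.\<close>

definition adj_op :: "('h::complex_hilbert_space \<Rightarrow>\<^sub>L 'h) \<Rightarrow> ('h \<Rightarrow>\<^sub>L 'h)"
  where "adj_op T = (THE S :: 'h \<Rightarrow>\<^sub>L 'h. \<forall>x y. cinner (T x) y = cinner x (S y))"

text \<open>Subspaces of \<open>B(H)\<close> that are closed under products; no identity and no norm closedness
  is required.\<close>

definition operator_subspace :: "('h::complex_hilbert_space \<Rightarrow>\<^sub>L 'h) set \<Rightarrow> bool"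
  where "operator_subspace V \<longleftrightarrow> V \<subseteq> complex_linear_ops \<and> 0 \<in> V \<and>
    (\<forall>x\<in>V. \<forall>y\<in>V. x + y \<in> V) \<and> (\<forall>c. \<forall>x\<in>V. c *\<^sub>O x \<in> V)"

definition algebra_of_operators :: "('h::complex_hilbert_space \<Rightarrow>\<^sub>L 'h) set \<Rightarrow> bool"
  where "algebra_of_operators B \<longleftrightarrow> operator_subspace B \<and> (\<forall>x\<in>B. \<forall>y\<in>B. x o\<^sub>L y \<in> B)"

definition unital_operator_algebra :: "('h::complex_hilbert_space \<Rightarrow>\<^sub>L 'h) set \<Rightarrow> bool"
  where "unital_operator_algebra A \<longleftrightarrow>
    algebra_of_operators A \<and> closed A \<and> id_blinfun \<in> A"

definition is_subalgebra ::
  "('h::complex_hilbert_space \<Rightarrow>\<^sub>L 'h) set \<Rightarrow> ('h \<Rightarrow>\<^sub>L 'h) set \<Rightarrow> bool"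
  where "is_subalgebra B A \<longleftrightarrow> B \<subseteq> A \<and> algebra_of_operators B"

definition closed_algebra_generated ::
  "('h::complex_hilbert_space \<Rightarrow>\<^sub>L 'h) set \<Rightarrow> ('h \<Rightarrow>\<^sub>L 'h) set"
  where "closed_algebra_generated S = \<Inter>{B. algebra_of_operators B \<and> closed B \<and> S \<subseteq> B}"

text \<open>An \<open>n \<times> n\<close> operator matrix is a function of two indices, of which only the values at indices
  below \<open>n\<close> matter; it acts on the Hilbert space sum of \<open>n\<close> copies of \<open>H\<close>, whose vectors are
  likewise represented by functions on \<open>nat\<close>, and \<open>mat_norm\<close> is its operator norm there.\<close>

type_synonym 'h op_matrix = "nat \<Rightarrow> nat \<Rightarrow> ('h \<Rightarrow>\<^sub>L 'h)"

definition matrices_over :: "nat \<Rightarrow> ('h::complex_hilbert_space \<Rightarrow>\<^sub>L 'h) set \<Rightarrow> 'h op_matrix set"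
  where "matrices_over n A = {X. \<forall>i<n. \<forall>j<n. X i j \<in> A}"

definition mat_apply ::
  "nat \<Rightarrow> ('h::complex_hilbert_space) op_matrix \<Rightarrow> (nat \<Rightarrow> 'h) \<Rightarrow> nat \<Rightarrow> 'h"
  where "mat_apply n X v i = (\<Sum>j<n. X i j (v j))"

definition vec_norm :: "nat \<Rightarrow> (nat \<Rightarrow> 'h::complex_hilbert_space) \<Rightarrow> real"
  where "vec_norm n v = L2_set (\<lambda>i. norm (v i)) {..<n}"

definition mat_norm :: "nat \<Rightarrow> ('h::complex_hilbert_space) op_matrix \<Rightarrow> real"
  where "mat_norm n X = (SUP v\<in>{v. vec_norm n v \<le> 1}. vec_norm n (mat_apply n X v))"

text \<open>The supremum is over a bounded set.\<close>

lemma bdd_above_mat_norm: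
  fixes X :: "('h::complex_hilbert_space) op_matrix"
  shows "bdd_above ((\<lambda>v. vec_norm n (mat_apply n X v)) ` {v. vec_norm n v \<le> 1})"
proof (rule bdd_aboveI2)
  fix v :: "nat \<Rightarrow> 'h"
  assume "v \<in> {v. vec_norm n v \<le> 1}"
  then have v: "vec_norm n v \<le> 1" by simp
  have le1: "norm (v j) \<le> 1" if "j < n" for j
    using member_le_L2_set[of "{..<n}" j "\<lambda>i. norm (v i)"] that v by (simp add: vec_norm_def)
  have "norm (mat_apply n X v i) \<le> (\<Sum>j<n. norm (X i j))" for i
    unfolding mat_apply_def
  proof (rule sum_norm_le)
    fix j assume "j \<in> {..<n}"
    then show "norm (X i j (v j)) \<le> norm (X i j)"
      using norm_blinfun[of "X i j" "v j"] mult_left_le[OF le1[of j] norm_ge_zero[of "X i j"]]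
      by simp
  qed
  then show "vec_norm n (mat_apply n X v) \<le> L2_set (\<lambda>i. \<Sum>j<n. norm (X i j)) {..<n}"
    unfolding vec_norm_def by (intro L2_set_mono) auto
qed

definition mat_adj :: "('h::complex_hilbert_space) op_matrix \<Rightarrow> 'h op_matrix"
  where "mat_adj X = (\<lambda>i j. adj_op (X j i))"

definition mat_positive :: "nat \<Rightarrow> ('h::complex_hilbert_space) op_matrix \<Rightarrow> bool"
  where "mat_positive n X \<longleftrightarrow>
    (\<forall>v. (\<Sum>i<n. cinner (mat_apply n X v i) (v i)) \<in> \<real>\<^sub>\<ge>\<^sub>0)"

text \<open>The set \<open>{x \<in> M\<^sub>n(A). x + x\<^sup>* \<ge> 0}\<close>.\<close>

definition accretive :: "nat \<Rightarrow> ('h::complex_hilbert_space \<Rightarrow>\<^sub>L 'h) set \<Rightarrow> 'h op_matrix set"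
  where "accretive n A =
    {X \<in> matrices_over n A. mat_positive n (\<lambda>i j. X i j + mat_adj X i j)}"

definition amplification ::
  "(('h::complex_hilbert_space \<Rightarrow>\<^sub>L 'h) \<Rightarrow> ('h \<Rightarrow>\<^sub>L 'h)) \<Rightarrow> 'h op_matrix \<Rightarrow> 'h op_matrix"
  where "amplification P X = (\<lambda>i j. P (X i j))"

text \<open>Maps \<open>A \<rightarrow> A\<close> are total functions whose values outside \<open>A\<close> are irrelevant.\<close>

definition completely_contractive ::
  "('h::complex_hilbert_space \<Rightarrow>\<^sub>L 'h) set \<Rightarrow> (('h \<Rightarrow>\<^sub>L 'h) \<Rightarrow> ('h \<Rightarrow>\<^sub>L 'h)) \<Rightarrow> bool"
  where "completely_contractive A P \<longleftrightarrow>
    (\<forall>n. \<forall>X\<in>matrices_over n A. mat_norm n (amplification P X) \<le> mat_norm n X)"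

definition projection_on ::
  "('h::complex_hilbert_space \<Rightarrow>\<^sub>L 'h) set \<Rightarrow> (('h \<Rightarrow>\<^sub>L 'h) \<Rightarrow> ('h \<Rightarrow>\<^sub>L 'h)) \<Rightarrow> bool"
  where "projection_on A P \<longleftrightarrow> P ` A \<subseteq> A \<and>
    (\<forall>x\<in>A. \<forall>y\<in>A. P (x + y) = P x + P y) \<and> (\<forall>c. \<forall>x\<in>A. P (c *\<^sub>O x) = c *\<^sub>O P x) \<and>
    (\<forall>x\<in>A. P (P x) = P x)"

definition completely_bicontractive ::
  "('h::complex_hilbert_space \<Rightarrow>\<^sub>L 'h) set \<Rightarrow> (('h \<Rightarrow>\<^sub>L 'h) \<Rightarrow> ('h \<Rightarrow>\<^sub>L 'h)) \<Rightarrow> bool"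
  where "completely_bicontractive A P \<longleftrightarrow>
    completely_contractive A P \<and> completely_contractive A (\<lambda>x. x - P x)"

definition real_completely_positive ::
  "('h::complex_hilbert_space \<Rightarrow>\<^sub>L 'h) set \<Rightarrow> (('h \<Rightarrow>\<^sub>L 'h) \<Rightarrow> ('h \<Rightarrow>\<^sub>L 'h)) \<Rightarrow> bool"
  where "real_completely_positive A P \<longleftrightarrow>
    (\<forall>n. amplification P ` accretive n A \<subseteq> accretive n A)"

definition nilpotent_op :: "('h::complex_hilbert_space \<Rightarrow>\<^sub>L 'h) \<Rightarrow> bool"
  where "nilpotent_op x \<longleftrightarrow> (\<exists>k\<ge>1. (((o\<^sub>L) x) ^^ k) id_blinfun = 0)"

definition algebra_ideal ::
  "('h::complex_hilbert_space \<Rightarrow>\<^sub>L 'h) set \<Rightarrow> ('h \<Rightarrow>\<^sub>L 'h) set \<Rightarrow> bool"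
  where "algebra_ideal J D \<longleftrightarrow> J \<subseteq> D \<and> operator_subspace J \<and>
    (\<forall>d\<in>D. \<forall>x\<in>J. d o\<^sub>L x \<in> J \<and> x o\<^sub>L d \<in> J)"

definition semiprime_algebra :: "('h::complex_hilbert_space \<Rightarrow>\<^sub>L 'h) set \<Rightarrow> bool"
  where "semiprime_algebra D \<longleftrightarrow>
    (\<forall>J. algebra_ideal J D \<and> (\<forall>x\<in>J. \<forall>y\<in>J. x o\<^sub>L y = 0) \<longrightarrow> J = {0})"

end

theory Submission
  imports Defs
begin

text \<open>Let \<open>C\<close> be the kernel of \<open>P\<close>, let \<open>e = P(1)\<close>, and let \<open>D\<close> be the closed algebra generated by \<open>P(A)\<close>.
  The part \<open>C \<inter> D\<close> of the kernel is the only obstruction: for \<open>x, y \<in> P(A)\<close> the element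
  \<open>xy - P(xy)\<close> lies in it. It is a left ideal of \<open>D\<close> whose products all vanish. So every element of
  it squares to zero, and in a semiprime algebra such a left ideal is zero. Two facts about products
  make this work.
  
  First, \<open>P(A) C \<subseteq> C\<close> (\<open>P_range_times_kernel\<close>), hence \<open>D C \<subseteq> C\<close>. A \<open>3 \<times> 3\<close> Gram matrix, in which the
  product \<open>x x\<^sup>*\<close> that is not available in \<open>A\<close> is replaced by a larger operator \<open>s\<close>, is sent by \<open>P\<close>
  to another positive matrix. If \<open>d = P(x c)\<close> were not zero, the new matrix would allow the
  value of \<open>s\<close> at some vector to be lowered by a fixed amount, again and again, although \<open>s\<close> stays
  above \<open>x x\<^sup>* \<ge> 0\<close>. This is an elementary substitute for the theorem of Choi and Effros that the range of a completely
  positive projection carries a product for which the projection is a module map.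
  
  Second, \<open>C k C \<subseteq> P(A)\<close> for every selfadjoint \<open>k \<in> P(A)\<close> (\<open>kernel_middle_kernel\<close>). This uses that
  \<open>I - P\<close> is completely contractive, and is a case of Youngson's theorem on completely contractive
  projections. The Moebius flow \<open>\<Gamma> \<mapsto> \<Gamma> + t (E - \<Gamma> E\<^sup>* \<Gamma>)\<close> preserves the unit ball up to an error of
  order \<open>t\<^sup>2\<close>. With \<open>\<Gamma>\<close> having \<open>c\<^sub>1, c\<^sub>2\<close> off the diagonal and \<open>E\<close> having \<open>k\<close> in a corner, one step
  followed by \<open>I - P\<close> moves the other corner by \<open>t\<close> times \<open>(I - P)(c\<^sub>1 k c\<^sub>2)\<close> and changes nothing
  else. After \<open>n\<^sup>2\<close> steps of size \<open>1/n\<close> the corner is of order \<open>n\<close> while the norm is bounded.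
  
  Both facts together, applied to \<open>e\<close> and \<open>e - e\<^sup>2\<close>, show that \<open>e\<close> is a projection and a left identity
  of \<open>D\<close> (\<open>e_idempotent\<close>, \<open>e_left_identity\<close>). For \<open>i, j \<in> C \<inter> D\<close> the product \<open>i j = i e j\<close> is then
  in \<open>P(A)\<close> by the second fact and in \<open>C\<close> by the first one, so it is zero.\<close>

section \<open>The Riesz representation theorem and adjoints\<close>

lemma linear_term_zero_if_quadratic_nonneg:
  fixes a b :: real
  assumes "\<And>t. 0 \<le> t\<^sup>2 * a + t * b"
  shows "b = 0"
proof (rule ccontr)
  assume "b \<noteq> 0"
  define t where "t = - b / (\<bar>a\<bar> + 1)"
  have "t\<^sup>2 * a + t * b = b\<^sup>2 * (a / (\<bar>a\<bar> + 1) - 1) / (\<bar>a\<bar> + 1)"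
    by (simp add: t_def power2_eq_square diff_divide_distrib right_diff_distrib)
  moreover have "a / (\<bar>a\<bar> + 1) - 1 < 0"
    by (simp add: field_simps)
  ultimately have "t\<^sup>2 * a + t * b < 0"
    using \<open>b \<noteq> 0\<close> by (simp add: divide_neg_pos mult_pos_neg)
  with assms[of t] show False by simp
qed

text \<open>The representing vector minimises \<open>\<parallel>x\<parallel>\<^sup>2 - 2 f x\<close>. By the parallelogram law a minimising sequence is
  Cauchy, and at the minimum the derivative in every direction vanishes.\<close>

lemma riesz_representation:
  fixes f :: "'a::{real_inner, complete_space} \<Rightarrow> real"
  assumes "bounded_linear f"
  shows "\<exists>a. \<forall>x. f x = inner x a"
proof -
  interpret f: bounded_linear f by fact
  define F where "F x = (norm x)\<^sup>2 - 2 * f x" for x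
  obtain K where K: "\<And>x. norm (f x) \<le> norm x * K"
    using f.bounded by blast
  have lower: "- K\<^sup>2 \<le> F x" for x
  proof -
    have "f x \<le> norm x * K" using K[of x] by simp
    moreover have "0 \<le> (norm x - K)\<^sup>2" by simp
    ultimately show ?thesis by (simp add: F_def power2_eq_square algebra_simps)
  qed
  define m where "m = Inf (range F)"
  have bdd: "bdd_below (range F)" using lower by (auto intro!: bdd_belowI)
  have m: "m \<le> F x" for x
    unfolding m_def using bdd by (intro cInf_lower) auto
  have "\<exists>x. F x < m + 1 / Suc n" for n
    using cInf_lessD[of "range F" "m + 1 / Suc n"] by (auto simp: m_def)
  then obtain x where x: "\<And>n. F (x n) < m + 1 / Suc n" by metis
  have par: "(norm (u - v))\<^sup>2 \<le> 2 * (F u - m) + 2 * (F v - m)" for u v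
  proof -
    have "(norm (u - v))\<^sup>2 = 2 * F u + 2 * F v - 4 * F ((1/2) *\<^sub>R (u + v))"
      by (simp add: F_def f.add f.scaleR power2_norm_eq_inner inner_commute algebra_simps)
    with m[of "(1/2) *\<^sub>R (u + v)"] show ?thesis by simp
  qed
  have "Cauchy x"
  proof (rule metric_CauchyI)
    fix e :: real assume "0 < e"
    then obtain M where M: "4 / e\<^sup>2 < real M"
      using reals_Archimedean2 by blast
    show "\<exists>M. \<forall>i\<ge>M. \<forall>j\<ge>M. dist (x i) (x j) < e"
    proof (intro exI[of _ M] allI impI)
      fix i j assume "M \<le> i" "M \<le> j"
      have "M > 0" using M \<open>0 < e\<close> by (cases "M = 0") (auto simp: field_simps)
      have "1 / Suc i \<le> 1 / M" "1 / Suc j \<le> 1 / M"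
        using \<open>M \<le> i\<close> \<open>M \<le> j\<close> \<open>M > 0\<close> by (auto simp: field_simps)
      then have "(norm (x i - x j))\<^sup>2 < 4 / M"
        using par[of "x i" "x j"] x[of i] x[of j] by simp
      also have "\<dots> < e\<^sup>2"
        using M \<open>0 < e\<close> \<open>M > 0\<close> by (simp add: field_simps)
      finally show "dist (x i) (x j) < e"
        using \<open>0 < e\<close> by (simp add: dist_norm power_less_imp_less_base)
    qed
  qed
  then obtain a where a: "x \<longlonglongrightarrow> a"
    by (metis Cauchy_convergent_iff convergent_def)
  have "(\<lambda>n. F (x n)) \<longlonglongrightarrow> F a"
    unfolding F_def by (intro tendsto_intros f.tendsto a)
  moreover have "(\<lambda>n. m + 1 / Suc n) \<longlonglongrightarrow> m + 0"
    by (intro tendsto_add tendsto_const LIMSEQ_Suc lim_1_over_n)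
  ultimately have "F a \<le> m + 0"
    by (rule LIMSEQ_le) (use x less_imp_le in blast)
  then have min: "F a \<le> F v" for v
    using m[of v] by simp
  have "f v = inner v a" for v
  proof -
    have "0 \<le> t\<^sup>2 * (norm v)\<^sup>2 + t * (2 * (inner v a - f v))" for t
      using min[of "a + t *\<^sub>R v"] unfolding F_def power2_norm_eq_inner
      by (simp add: f.add f.scaleR inner_add inner_commute power2_eq_square algebra_simps)
    then have "2 * (inner v a - f v) = 0"
      by (rule linear_term_zero_if_quadratic_nonneg)
    then show ?thesis by simp
  qed
  then show ?thesis by blast
qed

lemma adjoint_exists:
  fixes T :: "'a::{real_inner, complete_space} \<Rightarrow>\<^sub>L 'a"
  shows "\<exists>S::'a \<Rightarrow>\<^sub>L 'a. \<forall>x y. inner (T x) y = inner x (S y)"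
proof -
  have "\<exists>a. \<forall>x. inner (T x) y = inner x a" for y
    by (intro riesz_representation bounded_linear_compose[OF bounded_linear_inner_left]
        blinfun.bounded_linear_right)
  then obtain S where S: "\<And>x y. inner (T x) y = inner x (S y)" by metis
  have "bounded_linear S"
  proof (rule bounded_linear_intro)
    show "S (x + y) = S x + S y" for x y
      by (rule vector_eq_ldot[THEN iffD1]) (simp add: inner_add_right flip: S)
    show "S (r *\<^sub>R x) = r *\<^sub>R S x" for r x
      by (rule vector_eq_ldot[THEN iffD1]) (simp flip: S)
    show "norm (S y) \<le> norm y * norm T" for y
    proof -
      have "(norm (S y))\<^sup>2 = inner (T (S y)) y" by (simp add: S power2_norm_eq_inner)
      also have "\<dots> \<le> norm T * norm (S y) * norm y"
        by (meson norm_blinfun norm_cauchy_schwarz norm_ge_zero mult_right_mono order_trans)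
      finally show ?thesis
        by (cases "norm (S y) = 0") (auto simp: power2_eq_square mult.commute mult.left_commute)
    qed
  qed
  then show ?thesis using S by (metis bounded_linear_Blinfun_apply)
qed

text \<open>This carries real adjoints over to the complex inner product.\<close>

lemma cinner_eq_inner:
  "cinner x y = Complex (inner x y) (- inner (\<i> *\<^sub>C x) (y :: 'h::complex_hilbert_space))"
  by (rule complex_eqI) (simp_all add: inner_eq_Re_cinner cinner_scaleC_left)

lemma cinner_adj_op:
  fixes T :: "'h::complex_hilbert_space \<Rightarrow>\<^sub>L 'h"
  assumes "T \<in> complex_linear_ops"
  shows "cinner (T x) y = cinner x (adj_op T y)"
proof -
  obtain S :: "'h \<Rightarrow>\<^sub>L 'h" where S: "\<And>x y. inner (T x) y = inner x (S y)"
    using adjoint_exists by metis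
  have "T (\<i> *\<^sub>C x) = \<i> *\<^sub>C T x" for x
    using assms by (simp add: complex_linear_ops_def)
  then have *: "\<forall>x y. cinner (T x) y = cinner x (S y)"
    by (metis S cinner_eq_inner)
  have "S' = S" if "\<forall>x y. cinner (T x) y = cinner x (S' y)" for S' :: "'h \<Rightarrow>\<^sub>L 'h"
  proof (rule blinfun_eqI)
    fix y
    have "inner x (S' y) = inner x (S y)" for x
      using that * by (simp add: inner_eq_Re_cinner)
    then show "S' y = S y" by (metis vector_eq_ldot)
  qed
  with * have "adj_op T = S"
    unfolding adj_op_def by (intro the_equality) auto
  with * show ?thesis by simp
qed

text \<open>The form of \<open>X + X\<^sup>*\<close> is twice the real part of the form of \<open>X\<close>, so the adjoint disappears from the
  positivity condition.\<close>

lemma accretive_iff: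
  assumes "A \<subseteq> complex_linear_ops"
  shows "X \<in> accretive n A \<longleftrightarrow> X \<in> matrices_over n A \<and>
    (\<forall>v. 0 \<le> (\<Sum>i<n. \<Sum>j<n. inner (X i j (v j)) (v i)))"
proof -
  have "(mat_positive n (\<lambda>i j. X i j + mat_adj X i j)) \<longleftrightarrow>
      (\<forall>v. 0 \<le> (\<Sum>i<n. \<Sum>j<n. inner (X i j (v j)) (v i)))"
    if X: "X \<in> matrices_over n A"
  proof -
    have CL: "X i j \<in> complex_linear_ops" if "i < n" "j < n" for i j
      using X assms that by (auto simp: matrices_over_def)
    have "(\<Sum>i<n. cinner (mat_apply n (\<lambda>i j. X i j + mat_adj X i j) v i) (v i)) =
      complex_of_real (2 * (\<Sum>i<n. \<Sum>j<n. inner (X i j (v j)) (v i)))" for v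
    proof -
      have csum: "cinner (\<Sum>j\<in>S. g j) w = (\<Sum>j\<in>S. cinner (g j) w)" for S :: "nat set" and g and w :: 'a
      proof (induction S rule: infinite_finite_induct)
        have z: "cinner 0 w = 0" by (metis add_cancel_right_right cinner_add_left)
        case (infinite A) then show ?case by (simp add: z)
      next
        case empty then show ?case by (metis add_cancel_right_right cinner_add_left sum.empty)
      qed (simp add: cinner_add_left)
      define z where "z i j = cinner (X i j (v j)) (v i)" for i j
      have "(\<Sum>i<n. cinner (mat_apply n (\<lambda>i j. X i j + mat_adj X i j) v i) (v i)) =
         (\<Sum>i<n. \<Sum>j<n. z i j + cnj (z j i))"
        unfolding mat_apply_def csum z_def
      proof (intro sum.cong refl, goal_cases)
        case (1 i j)
        have "cinner (adj_op (X j i) (v j)) (v i) = cnj (cinner (X j i (v i)) (v j))"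
          using 1 CL by (simp add: cinner_adj_op cinner_commute[of _ "v i"])
        then show ?case
          by (simp add: mat_adj_def blinfun.add_left cinner_add_left)
      qed
      also have "\<dots> = (\<Sum>i<n. \<Sum>j<n. z i j) + cnj (\<Sum>i<n. \<Sum>j<n. z i j)"
        by (simp add: sum.distrib sum.swap[of "\<lambda>i j. cnj (z j i)"])
      also have "\<dots> = complex_of_real (2 * Re (\<Sum>i<n. \<Sum>j<n. z i j))"
        by (rule complex_add_cnj)
      finally show ?thesis by (simp add: z_def inner_eq_Re_cinner)
    qed
    then show ?thesis by (simp add: mat_positive_def complex_nonneg_Reals_iff)
  qed
  then show ?thesis by (auto simp: accretive_def)
qed

section \<open>Norms of operator matrices\<close>

lemma mat_norm_le:
  assumes "0 \<le> B" "\<And>v. vec_norm n (mat_apply n X v) \<le> B * vec_norm n v"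
  shows "mat_norm n X \<le> B"
  unfolding mat_norm_def
proof (rule cSUP_least)
  show "{v. vec_norm n v \<le> 1} \<noteq> {}"
    by (auto intro!: exI[of _ "\<lambda>_. 0"] simp: vec_norm_def L2_set_def)
  show "vec_norm n (mat_apply n X v) \<le> B" if "v \<in> {v. vec_norm n v \<le> 1}" for v
    using assms(2)[of v] mult_left_mono[OF _ assms(1), of "vec_norm n v" 1] that by simp
qed

lemma vec_norm_scaleR: "vec_norm n (\<lambda>i. r *\<^sub>R v i) = \<bar>r\<bar> * vec_norm n v"
  by (simp add: vec_norm_def L2_set_def power_mult_distrib real_sqrt_mult flip: sum_distrib_left)

lemma vec_norm_mat_apply:
  fixes X :: "('h::complex_hilbert_space) op_matrix"
  shows "vec_norm n (mat_apply n X v) \<le> mat_norm n X * vec_norm n v"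
proof (cases "vec_norm n v = 0")
  case True
  then have "v j = 0" if "j < n" for j
    using that by (simp add: vec_norm_def L2_set_eq_0_iff)
  then have "mat_apply n X v i = 0" for i
    by (simp add: mat_apply_def)
  then have "vec_norm n (mat_apply n X v) = 0"
    by (simp add: vec_norm_def L2_set_def)
  with True show ?thesis by simp
next
  case False
  define r where "r = 1 / vec_norm n v"
  have pos: "0 < vec_norm n v"
    using False by (metis L2_set_nonneg order_le_less vec_norm_def)
  have "vec_norm n (\<lambda>i. r *\<^sub>R v i) \<le> 1"
    using pos by (simp add: vec_norm_scaleR r_def)
  then have "vec_norm n (mat_apply n X (\<lambda>i. r *\<^sub>R v i)) \<le> mat_norm n X"
    unfolding mat_norm_def by (intro cSUP_upper bdd_above_mat_norm) simp
  also have "mat_apply n X (\<lambda>i. r *\<^sub>R v i) = (\<lambda>i. r *\<^sub>R mat_apply n X v i)"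
    by (simp add: mat_apply_def fun_eq_iff blinfun.scaleR_right scaleR_right.sum)
  finally show ?thesis
    using pos by (simp add: vec_norm_scaleR r_def field_simps)
qed

section \<open>Numerical values of operators\<close>

lemma inner_imaginary_left:
  "inner (\<i> *\<^sub>C x) y = - inner x (\<i> *\<^sub>C (y :: 'h::complex_hilbert_space))"
proof -
  have "cinner x (\<i> *\<^sub>C y) = - \<i> * cinner x y"
    by (metis cinner_commute cinner_scaleC_left complex_cnj_i complex_cnj_mult)
  then show ?thesis
    by (simp add: inner_eq_Re_cinner cinner_scaleC_left)
qed

lemma scaleC_zero: "c *\<^sub>C 0 = (0 :: 'h::complex_hilbert_space)"
  by (metis add_cancel_left_left scaleC_add_right)

text \<open>Polarisation; the factor \<open>c\<close> lets the real inner product see the whole complex numerical value, and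
  over the reals alone the conclusion would fail for skew operators.\<close>

lemma operator_zero_if_numerical_values_zero:
  fixes d :: "'h::complex_hilbert_space \<Rightarrow>\<^sub>L 'h"
  assumes d: "d \<in> complex_linear_ops"
    and zero: "\<And>c u. inner (c *\<^sub>C d u) u = 0"
  shows "d = 0"
proof (rule blinfun_eqI)
  fix v
  have di: "d (\<i> *\<^sub>C u) = \<i> *\<^sub>C d u" for u
    using d by (simp add: complex_linear_ops_def)
  have cross: "inner (c *\<^sub>C d u) v + inner (c *\<^sub>C d v) u = 0" for c u v
    using zero[of c "u + v"] zero[of c u] zero[of c v]
    by (simp add: blinfun.add_right scaleC_add_right inner_add)
  have "inner (\<i> *\<^sub>C d v) u = 0" for u
    using cross[of 1 u "\<i> *\<^sub>C v"] cross[of "\<i>" u v]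
      scaleC_of_real[of 1 "d u"] scaleC_of_real[of 1 "\<i> *\<^sub>C d v"]
    by (simp add: di inner_imaginary_left[of "d u"])
  then have "\<i> *\<^sub>C d v = 0"
    by (metis inner_eq_zero_iff)
  then have "norm (\<i> *\<^sub>C d v) = 0"
    by simp
  then show "blinfun_apply d v = blinfun_apply 0 v"
    by (simp add: norm_scaleC)
qed

section \<open>Moebius perturbations of contractions\<close>

text \<open>For \<open>N = 1\<close> this is the first order part of the Moebius transformation
  \<open>\<Gamma> \<mapsto> (\<Gamma> + t E)(1 + t E\<^sup>* \<Gamma>)\<^sup>-\<^sup>1\<close> of the unit ball. Written with \<open>u = v - (t/N) E G v\<close>, the operator
  sends \<open>v\<close> to \<open>G u + t N E v\<close>. Once \<open>\<parallel>G u\<parallel>\<close> is estimated by \<open>N \<parallel>u\<parallel>\<close>, the terms linear in \<open>t\<close> cancel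
  in \<open>\<parallel>G u + t N E v\<parallel>\<^sup>2 - N\<^sup>2 \<parallel>v\<parallel>\<^sup>2\<close>.\<close>

lemma moebius_step:
  fixes G E :: "'v::real_inner \<Rightarrow> 'v"
  assumes G: "linear G" "\<And>v. norm (G v) \<le> N * norm v"
    and E: "\<And>u v. inner (E u) v = inner u (E v)" "\<And>v. norm (E v) \<le> norm v"
    and N: "0 < N"
  shows "norm (G v + (t * N) *\<^sub>R E v - (t / N) *\<^sub>R G (E (G v))) \<le> N * sqrt (1 + 4 * t\<^sup>2) * norm v"
proof -
  define u where "u = v - (t / N) *\<^sub>R E (G v)"
  have Gu: "G u = G v - (t / N) *\<^sub>R G (E (G v))"
    using G(1) by (simp add: u_def linear_diff linear_scale)
  have EG: "norm (E (G v)) \<le> N * norm v"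
    using E(2) G(2) order_trans by blast
  have GEG: "- (N\<^sup>2 * (norm v)\<^sup>2) \<le> inner (G (E (G v))) (E v)"
  proof -
    have "norm (G (E (G v))) \<le> N * (N * norm v)"
      using G(2)[of "E (G v)"] EG N by (meson mult_left_mono less_imp_le order_trans)
    then have "norm (G (E (G v))) * norm (E v) \<le> N * (N * norm v) * norm v"
      using E(2)[of v] N by (intro mult_mono) auto
    then have "\<bar>inner (G (E (G v))) (E v)\<bar> \<le> N * (N * norm v) * norm v"
      using Cauchy_Schwarz_ineq2[of "G (E (G v))" "E v"] by linarith
    then show ?thesis by (simp add: power2_eq_square algebra_simps)
  qed
  have "(norm (G u + (t * N) *\<^sub>R E v))\<^sup>2
      = (norm (G u))\<^sup>2 + 2 * (t * N) * inner (G u) (E v) + t\<^sup>2 * N\<^sup>2 * (norm (E v))\<^sup>2"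
    unfolding power2_norm_eq_inner
    by (simp add: inner_add inner_commute algebra_simps power2_eq_square)
  also have "\<dots> \<le> N\<^sup>2 * (norm u)\<^sup>2 + 2 * (t * N) * inner (G u) (E v) + t\<^sup>2 * N\<^sup>2 * (norm v)\<^sup>2"
  proof -
    have "(norm (G u))\<^sup>2 \<le> N\<^sup>2 * (norm u)\<^sup>2"
      using power_mono[OF G(2)[of u], of 2] by (simp add: power_mult_distrib)
    moreover have "t\<^sup>2 * N\<^sup>2 * (norm (E v))\<^sup>2 \<le> t\<^sup>2 * N\<^sup>2 * (norm v)\<^sup>2"
      using E(2)[of v] by (intro mult_left_mono power_mono) auto
    ultimately show ?thesis by linarith
  qed
  also have "N\<^sup>2 * (norm u)\<^sup>2
      = N\<^sup>2 * (norm v)\<^sup>2 - 2 * (t * N) * inner (G v) (E v) + t\<^sup>2 * (norm (E (G v)))\<^sup>2"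
    using N E(1)[of "G v" v] unfolding power2_norm_eq_inner u_def
    by (simp add: inner_diff inner_commute field_simps power2_eq_square)
  also have "inner (G u) (E v) = inner (G v) (E v) - (t / N) * inner (G (E (G v))) (E v)"
    by (simp add: Gu inner_diff_left)
  also have "N\<^sup>2 * (norm v)\<^sup>2 - 2 * (t * N) * inner (G v) (E v) + t\<^sup>2 * (norm (E (G v)))\<^sup>2
      + 2 * (t * N) * (inner (G v) (E v) - (t / N) * inner (G (E (G v))) (E v))
      + t\<^sup>2 * N\<^sup>2 * (norm v)\<^sup>2
    = N\<^sup>2 * (norm v)\<^sup>2 + t\<^sup>2 * ((norm (E (G v)))\<^sup>2
        + 2 * (- inner (G (E (G v))) (E v)) + N\<^sup>2 * (norm v)\<^sup>2)"
    using N by (simp add: field_simps power2_eq_square)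
  also have "\<dots> \<le> N\<^sup>2 * (norm v)\<^sup>2 + t\<^sup>2 * ((N * norm v)\<^sup>2
        + 2 * (N\<^sup>2 * (norm v)\<^sup>2) + N\<^sup>2 * (norm v)\<^sup>2)"
    using power_mono[OF EG, of 2] GEG by (intro add_mono mult_left_mono) auto
  also have "\<dots> = (N * sqrt (1 + 4 * t\<^sup>2) * norm v)\<^sup>2"
    by (simp add: power_mult_distrib algebra_simps)
  finally have "norm (G u + (t * N) *\<^sub>R E v) \<le> N * sqrt (1 + 4 * t\<^sup>2) * norm v"
    using N by (auto intro!: power2_le_imp_le)
  then show ?thesis by (simp add: Gu algebra_simps)
qed

section \<open>Square-zero ideals\<close>

lemma blinfun_compose_assoc: "(a o\<^sub>L b) o\<^sub>L c = a o\<^sub>L (b o\<^sub>L c)"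
  by (rule blinfun_eqI) simp

lemma scaleR_op: "r *\<^sub>R x = complex_of_real r *\<^sub>O (x :: 'h::complex_hilbert_space \<Rightarrow>\<^sub>L 'h)"
  by (rule blinfun_eqI) (simp add: scaleC_op.rep_eq scaleC_of_real blinfun.scaleR_left)

lemma selfadjoint_square_zero:
  fixes g :: "'h::real_inner \<Rightarrow>\<^sub>L 'h"
  assumes "\<And>u v. inner (g u) v = inner u (g v)" "g o\<^sub>L g = 0"
  shows "g = 0"
proof (rule blinfun_eqI)
  fix u
  have "inner (g u) (g u) = inner u ((g o\<^sub>L g) u)" by (simp add: assms(1))
  then show "blinfun_apply g u = blinfun_apply 0 u" by (simp add: assms(2))
qed

text \<open>Semiprimeness speaks of two-sided ideals only. If \<open>R\<close> is the left annihilator of \<open>J\<close>, the set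
  \<open>{z \<in> R. R z = 0}\<close> is a two-sided ideal of square zero, and it contains \<open>J\<close>.\<close>

lemma left_square_zero_ideal_in_semiprime:
  fixes D :: "('h::complex_hilbert_space \<Rightarrow>\<^sub>L 'h) set"
  assumes D: "algebra_of_operators D" "semiprime_algebra D"
    and J: "J \<subseteq> D" "\<And>d j. d \<in> D \<Longrightarrow> j \<in> J \<Longrightarrow> d o\<^sub>L j \<in> J"
    and sq: "\<And>i j. i \<in> J \<Longrightarrow> j \<in> J \<Longrightarrow> i o\<^sub>L j = 0"
  shows "J \<subseteq> {0}"
proof -
  define R where "R = {z \<in> D. \<forall>j\<in>J. z o\<^sub>L j = 0}"
  define K where "K = {z \<in> R. \<forall>r\<in>R. r o\<^sub>L z = 0}"
  have sc: "(c *\<^sub>O a) o\<^sub>L b = c *\<^sub>O (a o\<^sub>L b)" for c and a b :: "'h \<Rightarrow>\<^sub>L 'h"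
    by (rule blinfun_eqI) (simp add: scaleC_op.rep_eq)
  have sc': "a o\<^sub>L (c *\<^sub>O b) = c *\<^sub>O (a o\<^sub>L b)" if "a \<in> D" for c and a b :: "'h \<Rightarrow>\<^sub>L 'h"
    using that D(1) by (intro blinfun_eqI)
      (auto simp: scaleC_op.rep_eq algebra_of_operators_def operator_subspace_def
        complex_linear_ops_def)
  have s0: "c *\<^sub>O 0 = (0 :: 'h \<Rightarrow>\<^sub>L 'h)" for c
    by (rule blinfun_eqI) (simp add: scaleC_op.rep_eq scaleC_zero)
  have "algebra_ideal K D"
    unfolding algebra_ideal_def operator_subspace_def
  proof (intro conjI ballI allI)
    show "K \<subseteq> D" "K \<subseteq> complex_linear_ops" "0 \<in> K"
      using D(1) by (auto simp: K_def R_def algebra_of_operators_def operator_subspace_def)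
    show "x + y \<in> K" if "x \<in> K" "y \<in> K" for x y
      using D(1) that by (auto simp: K_def R_def algebra_of_operators_def operator_subspace_def
        bounded_bilinear.add_left[OF bounded_bilinear_blinfun_compose]
        bounded_bilinear.add_right[OF bounded_bilinear_blinfun_compose])
    show "c *\<^sub>O x \<in> K" if "x \<in> K" for c x
      using D(1) that by (auto simp: K_def R_def algebra_of_operators_def operator_subspace_def
        sc sc' s0)
    show "d o\<^sub>L x \<in> K" "x o\<^sub>L d \<in> K" if "d \<in> D" "x \<in> K" for d x
    proof -
      have *: "d o\<^sub>L x \<in> D" "x o\<^sub>L d \<in> D"
        using D(1) that by (auto simp: K_def R_def algebra_of_operators_def)
      have "r o\<^sub>L d \<in> R" if "r \<in> R" for r
        using D(1) that \<open>d \<in> D\<close> J(2)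
        by (auto simp: R_def algebra_of_operators_def blinfun_compose_assoc)
      with that have "r o\<^sub>L (d o\<^sub>L x) = 0" "r o\<^sub>L (x o\<^sub>L d) = 0" if "r \<in> R" for r
        using that by (simp_all add: K_def flip: blinfun_compose_assoc)
      with that * J(2) show "d o\<^sub>L x \<in> K" "x o\<^sub>L d \<in> K"
        by (auto simp: K_def R_def blinfun_compose_assoc)
    qed
  qed
  moreover have "x o\<^sub>L y = 0" if "x \<in> K" "y \<in> K" for x y
    using that by (simp add: K_def)
  ultimately have "K = {0}"
    using D(2) by (simp add: semiprime_algebra_def)
  moreover have "J \<subseteq> K"
    using J sq by (auto simp: K_def R_def)
  ultimately show ?thesis by simp
qed

section \<open>Bicontractive projections in terms of quadratic forms\<close>

locale bicontractive_projection =
  fixes A :: "('h::complex_hilbert_space \<Rightarrow>\<^sub>L 'h) set"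
    and P :: "('h \<Rightarrow>\<^sub>L 'h) \<Rightarrow> ('h \<Rightarrow>\<^sub>L 'h)"
  assumes alg: "unital_operator_algebra A"
    and proj: "projection_on A P"
    and bicontractive: "completely_bicontractive A P"
    and real_positive: "real_completely_positive A P"
begin

definition e where "e = P id_blinfun"

lemma A_linear: "A \<subseteq> complex_linear_ops"
  and A_zero: "0 \<in> A"
  and A_add: "x \<in> A \<Longrightarrow> y \<in> A \<Longrightarrow> x + y \<in> A"
  and A_scaleC: "x \<in> A \<Longrightarrow> c *\<^sub>O x \<in> A"
  and A_mult: "x \<in> A \<Longrightarrow> y \<in> A \<Longrightarrow> x o\<^sub>L y \<in> A"
  and A_id: "id_blinfun \<in> A"
  and A_closed: "closed A"
  using alg by (auto simp: unital_operator_algebra_def algebra_of_operators_def operator_subspace_def)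

lemma A_scaleR: "x \<in> A \<Longrightarrow> r *\<^sub>R x \<in> A"
  by (simp add: scaleR_op A_scaleC)

lemma A_minus: "x \<in> A \<Longrightarrow> - x \<in> A"
  using A_scaleR[of x "- 1"] by simp

lemma A_diff: "x \<in> A \<Longrightarrow> y \<in> A \<Longrightarrow> x - y \<in> A"
  using A_add[of x "- y"] A_minus by simp

lemmas A_intros = A_zero A_add A_scaleC A_scaleR A_minus A_diff A_mult A_id

lemma P_in: "x \<in> A \<Longrightarrow> P x \<in> A"
  and P_add: "x \<in> A \<Longrightarrow> y \<in> A \<Longrightarrow> P (x + y) = P x + P y"
  and P_scaleC: "x \<in> A \<Longrightarrow> P (c *\<^sub>O x) = c *\<^sub>O P x"
  and P_idem: "x \<in> A \<Longrightarrow> P (P x) = P x"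
  using proj by (auto simp: projection_on_def)

lemma P_scaleR: "x \<in> A \<Longrightarrow> P (r *\<^sub>R x) = r *\<^sub>R P x"
  by (simp add: scaleR_op P_scaleC)

lemma P_minus: "x \<in> A \<Longrightarrow> P (- x) = - P x"
  using P_scaleR[of x "- 1"] by simp

lemma P_diff: "x \<in> A \<Longrightarrow> y \<in> A \<Longrightarrow> P (x - y) = P x - P y"
  using P_add[of x "- y"] P_minus[of y] A_minus[of y] by simp

lemma P_zero: "P 0 = 0"
  using P_scaleR[OF A_zero, of 0] by simp

lemma e_in: "e \<in> A" and P_e: "P e = e"
  by (simp_all add: e_def P_in P_idem A_id)

lemma op_scaleC: "x \<in> A \<Longrightarrow> x (c *\<^sub>C u) = c *\<^sub>C x u"
  using A_linear by (auto simp: complex_linear_ops_def)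

lemma real_positive_form:
  fixes X :: "'h op_matrix"
  assumes "\<And>i j. i < n \<Longrightarrow> j < n \<Longrightarrow> X i j \<in> A"
    and "\<And>v. 0 \<le> (\<Sum>i<n. \<Sum>j<n. inner (X i j (v j)) (v i))"
  shows "0 \<le> (\<Sum>i<n. \<Sum>j<n. inner (P (X i j) (v j)) (v i))"
proof -
  have "X \<in> accretive n A"
    using assms by (simp add: accretive_iff[OF A_linear] matrices_over_def)
  then have "amplification P X \<in> accretive n A"
    using real_positive by (auto simp: real_completely_positive_def)
  then show ?thesis
    by (simp add: accretive_iff[OF A_linear] amplification_def)
qed

lemma real_positive_1:
  assumes "x \<in> A" "\<And>u. 0 \<le> inner (x u) u"
  shows "0 \<le> inner (P x u) u"
  using real_positive_form[of "Suc 0" "\<lambda>_ _. x" "\<lambda>_. u"] assms by (simp add: lessThan_Suc)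

text \<open>The positivity condition for \<open>[[a, 0, b], [x, s, y], [0, 0, k]]\<close>, which is where products of range
  and kernel elements will be placed.\<close>

lemma real_positive_3:
  assumes A: "a \<in> A" "b \<in> A" "x \<in> A" "s \<in> A" "y \<in> A" "k \<in> A"
    and pos: "\<And>u v w. 0 \<le> inner (a u) u + inner (b w) u + inner (x u) v + inner (s v) v
        + inner (y w) v + inner (k w) w"
  shows "0 \<le> inner (P a u) u + inner (P b w) u + inner (P x u) v + inner (P s v) v
        + inner (P y w) v + inner (P k w) w"
proof -
  define X where "X i j =
    (if i = 0 then (if j = 0 then a else if j = 1 then 0 else b)
     else if i = 1 then (if j = 0 then x else if j = 1 then s else y)
     else (if j = 2 then k else 0))" for i j :: nat
  define V where "V i = (if i = 0 then u else if i = 1 then v else w)" for i :: nat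
  have "0 \<le> (\<Sum>i<3. \<Sum>j<3. inner (P (X i j) (V j)) (V i))"
  proof (rule real_positive_form)
    show "X i j \<in> A" for i j
      using A A_zero by (simp add: X_def)
    show "0 \<le> (\<Sum>i<3. \<Sum>j<3. inner (X i j (f j)) (f i))" for f
      using pos[of "f 0" "f 2" "f 1"]
      by (simp add: X_def numeral_3_eq_3 lessThan_Suc numeral_2_eq_2 algebra_simps)
  qed
  then show ?thesis
    by (simp add: X_def V_def numeral_3_eq_3 lessThan_Suc numeral_2_eq_2 P_zero algebra_simps)
qed

lemma P_contractive:
  assumes "x \<in> A"
  shows "norm (P x) \<le> norm x"
proof (rule norm_blinfun_bound)
  fix u
  have v1: "vec_norm (Suc 0) v = norm (v 0)" for v :: "nat \<Rightarrow> 'h"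
    by (simp add: vec_norm_def L2_set_def)
  have "norm (P x u) = vec_norm 1 (mat_apply 1 (amplification P (\<lambda>_ _. x)) (\<lambda>_. u))"
    by (simp add: v1 mat_apply_def amplification_def)
  also have "\<dots> \<le> mat_norm 1 (amplification P (\<lambda>_ _. x)) * norm u"
    using vec_norm_mat_apply[of 1 _ "\<lambda>_. u"] by (simp add: v1)
  also have "\<dots> \<le> mat_norm 1 (\<lambda>_ _. x) * norm u"
    using bicontractive assms
    by (intro mult_right_mono)
      (auto simp: completely_bicontractive_def completely_contractive_def matrices_over_def)
  also have "\<dots> \<le> norm x * norm u"
    by (intro mult_right_mono mat_norm_le) (auto simp: v1 mat_apply_def norm_blinfun)
  finally show "norm (P x u) \<le> norm x * norm u" .
qed simp

lemma complement_contractive_2: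
  assumes A: "a \<in> A" "b \<in> A" "c \<in> A" "d \<in> A"
    and N: "0 \<le> N" "\<And>u v. norm (a u + b v, c u + d v) \<le> N * norm (u, v)"
  shows "norm ((a - P a) u + (b - P b) v, (c - P c) u + (d - P d) v) \<le> N * norm (u, v)"
proof -
  define X where "X i j = (if i = 0 then (if j = 0 then a else b)
     else (if j = 0 then c else d))" for i j :: nat
  define V where "V i = (if i = 0 then u else v)" for i :: nat
  have v2: "vec_norm (Suc (Suc 0)) f = norm (f 0, f 1)" for f :: "nat \<Rightarrow> 'h"
    by (simp add: vec_norm_def L2_set_def norm_Pair)
  have "mat_norm 2 X \<le> N"
    using N by (intro mat_norm_le) (auto simp: v2 mat_apply_def X_def numeral_2_eq_2)
  moreover have "mat_norm 2 (amplification (\<lambda>x. x - P x) X) \<le> mat_norm 2 X"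
    using bicontractive A unfolding completely_bicontractive_def completely_contractive_def
    by (auto simp: matrices_over_def X_def)
  ultimately have "mat_norm 2 (amplification (\<lambda>x. x - P x) X) * vec_norm 2 V \<le> N * vec_norm 2 V"
    by (intro mult_right_mono) (auto simp: v2 numeral_2_eq_2)
  with vec_norm_mat_apply[of 2 "amplification (\<lambda>x. x - P x) X" V]
  have "vec_norm 2 (mat_apply 2 (amplification (\<lambda>x. x - P x) X) V) \<le> N * vec_norm 2 V"
    by linarith
  then show ?thesis
    by (simp add: v2 mat_apply_def amplification_def X_def V_def numeral_2_eq_2)
qed

lemma e_contraction: "norm (e u) \<le> norm u"
proof -
  have "norm e \<le> 1"
    using P_contractive[OF A_id] norm_blinfun_id_le order_trans unfolding e_def by blast
  then show ?thesis
    using norm_blinfun[of e u] mult_right_mono[of "norm e" 1 "norm u"] by simp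
qed

lemma e_le_1: "inner (e u) u \<le> (norm u)\<^sup>2"
  using norm_cauchy_schwarz[of "e u" u] mult_right_mono[OF e_contraction[of u], of "norm u"]
  by (simp add: power2_eq_square)

text \<open>Both \<open>\<i>\<close> and \<open>-\<i>\<close> are accretive, so \<open>\<i> e\<close> is skew-adjoint.\<close>

lemma e_selfadjoint: "inner (e u) v = inner u (e v)"
proof -
  have ortho: "inner (\<i> *\<^sub>C w) w = 0" for w :: 'h
    using inner_imaginary_left[of w w] by (simp add: inner_commute)
  have zero: "inner (\<i> *\<^sub>C e w) w = 0" for w
  proof -
    have "0 \<le> inner (P (\<i> *\<^sub>O id_blinfun) w) w" "0 \<le> inner (P (- (\<i> *\<^sub>O id_blinfun)) w) w"
      by (intro real_positive_1 A_intros, simp add: scaleC_op.rep_eq ortho blinfun.minus_left)+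
    then show ?thesis
      by (simp add: P_minus P_scaleC A_intros scaleC_op.rep_eq blinfun.minus_left flip: e_def)
  qed
  have cross: "inner (\<i> *\<^sub>C e a) b + inner (\<i> *\<^sub>C e b) a = 0" for a b
    using zero[of "a + b"] zero[of a] zero[of b]
    by (simp add: blinfun.add_right scaleC_add_right inner_add)
  have ii: "\<i> *\<^sub>C \<i> *\<^sub>C w = - w" for w :: 'h
    using scaleC_of_real[of "-1" w] by (simp add: scaleC_scaleC)
  show ?thesis
    using cross[of "\<i> *\<^sub>C u" v] inner_imaginary_left[of "e v" "\<i> *\<^sub>C u"]
    by (simp add: op_scaleC[OF e_in] ii inner_commute)
qed

section \<open>The range acts on the kernel\<close>

text \<open>\<open>S\<close> is the adjoint of \<open>x\<close>, and \<open>s\<close> bounds \<open>x x\<^sup>*\<close>. The matrix with entries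
  \<open>[[1, 0, 2c], [2x, s, 2xc], [0, 0, K]]\<close> has the form
  \<open>\<parallel>u + S v + c w\<parallel>\<^sup>2\<close> plus the defects of the bounds \<open>x x\<^sup>* \<le> s\<close> and \<open>c\<^sup>* c \<le> K\<close>. Under \<open>P\<close> the entry \<open>2c\<close>
  vanishes while \<open>2xc\<close> need not, and evaluation at \<open>(- S v, v, b v)\<close> gives a bound for \<open>x x\<^sup>*\<close> again, because the
  corner \<open>P 1 = e\<close> is at most \<open>1\<close>.\<close>

lemma norm_adjoint_le_positive_image:
  assumes x: "x \<in> A" "P x = x" and S: "\<And>u v. inner (x u) v = inner u (S v)"
    and c: "c \<in> A" "P c = 0" "(norm c)\<^sup>2 \<le> K"
    and s: "s \<in> A" "\<And>v. (norm (S v))\<^sup>2 \<le> inner (s v) v"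
  shows "(norm (S v))\<^sup>2 \<le> inner (P s v) v + 2 * inner (b *\<^sub>C P (x o\<^sub>L c) v) v
    + K * (cmod b)\<^sup>2 * inner (e v) v"
proof -
  define w where "w = b *\<^sub>C v"
  have "0 \<le> inner (P id_blinfun (- S v)) (- S v) + inner (P (2 *\<^sub>R c) w) (- S v)
    + inner (P (2 *\<^sub>R x) (- S v)) v + inner (P s v) v + inner (P (2 *\<^sub>R (x o\<^sub>L c)) w) v
    + inner (P (K *\<^sub>R id_blinfun) w) w"
  proof (rule real_positive_3)
    fix u v w
    have "(norm (c w))\<^sup>2 \<le> (norm c)\<^sup>2 * (norm w)\<^sup>2"
      using power_mono[OF norm_blinfun[of c w], of 2] by (simp add: power_mult_distrib)
    also have "\<dots> \<le> K * (norm w)\<^sup>2"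
      using c(3) by (rule mult_right_mono) simp
    finally have "0 \<le> (norm (u + S v + c w))\<^sup>2 + (inner (s v) v - (norm (S v))\<^sup>2)
        + (K * (norm w)\<^sup>2 - (norm (c w))\<^sup>2)"
      using s(2)[of v] by (simp add: add_nonneg_nonneg)
    also have "\<dots> = inner (id_blinfun u) u + inner ((2 *\<^sub>R c) w) u + inner ((2 *\<^sub>R x) u) v
        + inner (s v) v + inner ((2 *\<^sub>R (x o\<^sub>L c)) w) v + inner ((K *\<^sub>R id_blinfun) w) w"
      using inner_commute[of u "c w"] inner_commute[of "S v" u] inner_commute[of "S v" "c w"]
      unfolding power2_norm_eq_inner
      by (simp add: blinfun.scaleR_left blinfun.add_right inner_add flip: S)
    finally show "0 \<le> \<dots>" .
  qed (use x c s in \<open>auto intro: A_intros\<close>)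
  also have "\<dots> = inner (e (S v)) (S v) - 2 * (norm (S v))\<^sup>2 + inner (P s v) v
      + 2 * inner (P (x o\<^sub>L c) w) v + K * inner (e w) w"
    unfolding power2_norm_eq_inner
    by (simp add: P_scaleR x c A_intros blinfun.scaleR_left blinfun.minus_right S flip: e_def)
  also have "inner (e w) w = (cmod b)\<^sup>2 * inner (e v) v"
  proof -
    have "cinner (e w) w = b * (cnj b * cinner (e v) v)"
      unfolding w_def op_scaleC[OF e_in] cinner_scaleC_left
      by (metis cinner_commute cinner_scaleC_left complex_cnj_mult)
    also have "\<dots> = complex_of_real ((cmod b)\<^sup>2) * cinner (e v) v"
      by (simp only: complex_norm_square mult.assoc)
    finally show ?thesis by (simp add: inner_eq_Re_cinner)
  qed
  also have "P (x o\<^sub>L c) w = b *\<^sub>C P (x o\<^sub>L c) v"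
    unfolding w_def by (intro op_scaleC P_in A_mult x c)
  finally show ?thesis
    using e_le_1[of "S v"] by (simp add: mult.assoc)
qed

text \<open>The scalar bound \<open>x x\<^sup>* \<le> \<parallel>x\<^sup>*\<parallel>\<^sup>2\<close> improves under \<open>P\<close> to one by a multiple of \<open>e\<close>. It starts the descent
  below and shows that \<open>x\<^sup>*\<close> vanishes on the kernel of \<open>e\<close>.\<close>

lemma norm_adjoint_le_unit_image:
  fixes S :: "'h \<Rightarrow>\<^sub>L 'h"
  assumes x: "x \<in> A" "P x = x" and S: "\<And>u v. inner (x u) v = inner u (S v)"
  shows "(norm (S v))\<^sup>2 \<le> (norm S)\<^sup>2 * inner (e v) v"
proof -
  have "(norm (S v))\<^sup>2 \<le> inner (((norm S)\<^sup>2 *\<^sub>R id_blinfun) v) v" for v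
    using power_mono[OF norm_blinfun[of S v], of 2]
    by (simp add: power_mult_distrib blinfun.scaleR_left power2_norm_eq_inner)
  from norm_adjoint_le_positive_image[OF x S A_zero P_zero order_refl A_scaleR[OF A_id] this, of v 0]
  show ?thesis
    by (simp add: P_scaleR A_id e_def scaleC_zero norm_scaleC[of 0, simplified] P_zero
        blinfun.scaleR_left)
qed

text \<open>The bound \<open>M e + n r\<close> of \<open>x x\<^sup>*\<close>, where \<open>r = 2 b d + K \<bar>b\<bar>\<^sup>2 e\<close>, is fixed by \<open>P\<close>, so the previous lemma
  applies to it and yields the bound for \<open>n + 1\<close>. As all of them have nonnegative forms, so has \<open>r\<close>.
  For small \<open>b\<close> the term linear in \<open>b\<close> dominates \<open>r\<close>, so it vanishes for every \<open>b\<close>.\<close>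

lemma P_range_times_kernel:
  assumes x: "x \<in> A" "P x = x" and c: "c \<in> A" "P c = 0"
  shows "P (x o\<^sub>L c) = 0"
proof -
  define d where "d = P (x o\<^sub>L c)"
  have d: "d \<in> A" "P d = d"
    unfolding d_def by (auto intro!: P_in P_idem A_mult x c)
  obtain S :: "'h \<Rightarrow>\<^sub>L 'h" where S: "\<And>u v. inner (x u) v = inner u (S v)"
    using adjoint_exists by metis
  define M where "M = (norm S)\<^sup>2"
  define K where "K = (norm c)\<^sup>2"
  have bound: "0 \<le> 2 * inner (b *\<^sub>C d v) v + K * (cmod b)\<^sup>2 * inner (e v) v" for b v
  proof -
    define r where "r = 2 *\<^sub>R (b *\<^sub>O d) + (K * (cmod b)\<^sup>2) *\<^sub>R e"
    have r: "r \<in> A" "P r = r"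
      by (auto simp: r_def P_add P_scaleR P_scaleC A_intros d e_in P_e)
    have "(norm (S v))\<^sup>2 \<le> inner ((M *\<^sub>R e + real n *\<^sub>R r) v) v" for n v
    proof (induction n arbitrary: v)
      case 0
      show ?case
        using norm_adjoint_le_unit_image[OF x S] by (simp add: M_def blinfun.scaleR_left)
    next
      case (Suc n)
      have "M *\<^sub>R e + real n *\<^sub>R r \<in> A" "P (M *\<^sub>R e + real n *\<^sub>R r) = M *\<^sub>R e + real n *\<^sub>R r"
        by (auto simp: P_add P_scaleR A_intros r e_in P_e)
      with norm_adjoint_le_positive_image[OF x S c, of K "M *\<^sub>R e + real n *\<^sub>R r" v b] Suc
      show ?case
        by (simp add: K_def r_def d_def blinfun.bilinear_simps scaleC_op.rep_eq inner_add algebra_simps)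
    qed
    then have "0 \<le> inner ((M *\<^sub>R e + real n *\<^sub>R r) v) v" for n
      by (meson order_trans zero_le_power2)
    then have scaled: "- (M * inner (e v) v) \<le> real n * inner (r v) v" for n
      by (simp add: blinfun.bilinear_simps inner_add algebra_simps) (smt (verit))
    have "0 \<le> inner (r v) v"
    proof (rule ccontr)
      assume "\<not> 0 \<le> inner (r v) v"
      then have "0 < - inner (r v) v" by simp
      from reals_Archimedean3[OF this] obtain n where "M * inner (e v) v < real n * - inner (r v) v"
        by blast
      with scaled[of n] show False by simp
    qed
    then show ?thesis
      by (simp add: r_def blinfun.bilinear_simps scaleC_op.rep_eq inner_add)
  qed
  \<comment> \<open>Replacing \<open>b\<close> by \<open>t b\<close> with \<open>t\<close> real turns the bound into a quadratic polynomial in \<open>t\<close>.\<close>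
  have "inner (b *\<^sub>C d v) v = 0" for b v
  proof -
    have "0 \<le> t\<^sup>2 * (K * (cmod b)\<^sup>2 * inner (e v) v) + t * (2 * inner (b *\<^sub>C d v) v)" for t
    proof -
      have "(complex_of_real t * b) *\<^sub>C d v = t *\<^sub>R (b *\<^sub>C d v)"
        by (metis scaleC_of_real scaleC_scaleC)
      then show ?thesis
        using bound[of "complex_of_real t * b" v]
        by (simp add: norm_mult power_mult_distrib algebra_simps)
    qed
    from linear_term_zero_if_quadratic_nonneg[OF this] show ?thesis by simp
  qed
  then have "d = 0"
    using d A_linear by (intro operator_zero_if_numerical_values_zero) auto
  then show ?thesis by (simp add: d_def)
qed

section \<open>Products of kernel elements\<close>

text \<open>Let \<open>y = (I - P)(c\<^sub>1 k c\<^sub>2)\<close>, \<open>G \<tau> = [[-\<tau> y, c\<^sub>1], [c\<^sub>2, 0]]\<close> and \<open>E = [[0, 0], [0, k]]\<close>. Then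
  \<open>G \<tau> E G \<tau> = [[c\<^sub>1 k c\<^sub>2, 0], [0, 0]]\<close>, so a Moebius step followed by \<open>I - P\<close>, which kills \<open>k\<close> and fixes
  \<open>y, c\<^sub>1, c\<^sub>2\<close>, leads from \<open>G \<tau>\<close> to \<open>G (\<tau> + t/N)\<close>. Only a factor \<open>sqrt (1 + 4 t\<^sup>2)\<close> is lost in the norm:
  \<open>n\<^sup>2\<close> steps with \<open>t = 1/n\<close> lose at most \<open>exp 2\<close>, but increase \<open>\<tau>\<close> by at least a fixed
  multiple of \<open>n\<close>. So \<open>n \<parallel>y\<parallel>\<close> stays
  bounded as \<open>n\<close> grows.\<close>

lemma kernel_middle_kernel:
  assumes k: "k \<in> A" "P k = k" "\<And>u v. inner (k u) v = inner u (k v)" "\<And>u. norm (k u) \<le> norm u"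
    and c: "c\<^sub>1 \<in> A" "P c\<^sub>1 = 0" "c\<^sub>2 \<in> A" "P c\<^sub>2 = 0"
  shows "P (c\<^sub>1 o\<^sub>L k o\<^sub>L c\<^sub>2) = c\<^sub>1 o\<^sub>L k o\<^sub>L c\<^sub>2"
proof -
  define z where "z = c\<^sub>1 o\<^sub>L k o\<^sub>L c\<^sub>2"
  define y where "y = z - P z"
  have z: "z \<in> A" by (auto simp: z_def intro: A_intros k c)
  have y: "y \<in> A" "P y = 0"
    by (auto simp: y_def P_diff P_idem P_in z intro!: A_intros)
  define G where "G \<tau> w = (- \<tau> *\<^sub>R y (fst w) + c\<^sub>1 (snd w), c\<^sub>2 (fst w))" for \<tau> and w :: "'h \<times> 'h"
  define E :: "'h \<times> 'h \<Rightarrow> 'h \<times> 'h" where "E w = (0, k (snd w))" for w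
  have lin: "linear (G \<tau>)" for \<tau>
    by (rule linearI) (auto simp: G_def blinfun.bilinear_simps algebra_simps)
  have step: "norm (G (\<tau> + t / N) w) \<le> N * sqrt (1 + 4 * t\<^sup>2) * norm w"
    if N: "0 < N" "\<And>w. norm (G \<tau> w) \<le> N * norm w" for \<tau> t N w
  proof -
    define a where "a = - \<tau> *\<^sub>R y - (t / N) *\<^sub>R z"
    have "norm (a u + c\<^sub>1 v, c\<^sub>2 u + ((t * N) *\<^sub>R k) v) \<le> N * sqrt (1 + 4 * t\<^sup>2) * norm (u, v)" for u v
    proof -
      have "norm (G \<tau> (u, v) + (t * N) *\<^sub>R E (u, v) - (t / N) *\<^sub>R G \<tau> (E (G \<tau> (u, v))))
          \<le> N * sqrt (1 + 4 * t\<^sup>2) * norm (u, v)"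
        by (rule moebius_step[OF lin N(2) _ _ N(1)])
          (auto simp: E_def inner_prod_def k norm_Pair
            intro: order_trans[OF k(4)] norm_snd_le[THEN order_trans])
      also have "G \<tau> (u, v) + (t * N) *\<^sub>R E (u, v) - (t / N) *\<^sub>R G \<tau> (E (G \<tau> (u, v)))
          = (a u + c\<^sub>1 v, c\<^sub>2 u + ((t * N) *\<^sub>R k) v)"
        by (simp add: G_def E_def a_def z_def blinfun.bilinear_simps)
      finally show ?thesis .
    qed
    from complement_contractive_2[OF _ _ _ _ _ this, of "fst w" "snd w"]
    have "norm ((a - P a) (fst w) + (c\<^sub>1 - P c\<^sub>1) (snd w),
        (c\<^sub>2 - P c\<^sub>2) (fst w) + ((t * N) *\<^sub>R k - P ((t * N) *\<^sub>R k)) (snd w))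
      \<le> N * sqrt (1 + 4 * t\<^sup>2) * norm w"
      using N(1) by (auto simp: a_def intro!: A_intros y z c k)
    moreover have "a - P a = - (\<tau> + t / N) *\<^sub>R y"
    proof -
      have "P a = - (t / N) *\<^sub>R P z"
        using y z by (simp add: a_def P_diff P_scaleR P_minus A_intros)
      then show ?thesis
        by (simp add: a_def y_def algebra_simps)
    qed
    ultimately show ?thesis
      using c k by (simp add: G_def P_scaleR blinfun.bilinear_simps)
  qed
  define N\<^sub>0 where "N\<^sub>0 = 1 + norm c\<^sub>1 + norm c\<^sub>2"
  \<comment> \<open>\<open>L\<close> bounds the norm throughout the iteration, so each step adds at least \<open>1 / (n L)\<close> to \<open>\<tau>\<close>.\<close>
  define L where "L = N\<^sub>0 * exp 2"
  have N\<^sub>0: "0 < N\<^sub>0" by (simp add: N\<^sub>0_def add_pos_nonneg)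
  then have L: "0 < L" by (simp add: L_def)
  have start: "norm (G 0 w) \<le> N\<^sub>0 * norm w" for w
  proof -
    have "norm (c\<^sub>1 (snd w)) \<le> norm c\<^sub>1 * norm w"
      by (rule order_trans[OF norm_blinfun mult_left_mono])
        (metis norm_snd_le prod.collapse, simp)
    moreover have "norm (c\<^sub>2 (fst w)) \<le> norm c\<^sub>2 * norm w"
      by (rule order_trans[OF norm_blinfun mult_left_mono])
        (metis norm_fst_le prod.collapse, simp)
    ultimately show ?thesis
      using norm_Pair_le[of "c\<^sub>1 (snd w)" "c\<^sub>2 (fst w)"] norm_ge_zero[of w]
      unfolding G_def N\<^sub>0_def by (simp add: algebra_simps) (smt (verit) norm_ge_zero)
  qed
  have bound: "real n * norm (y u) \<le> L * L * norm u" if n: "0 < n" for n :: nat and u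
  proof -
    define q where "q = sqrt (1 + 4 * (1 / real n)\<^sup>2)"
    have q: "q ^ m \<le> exp 2" if m: "m \<le> n\<^sup>2" for m
    proof -
      have "q\<^sup>2 \<le> (exp (2 / (real n)\<^sup>2))\<^sup>2"
        using exp_ge_add_one_self[of "4 / (real n)\<^sup>2"]
        by (simp add: q_def power_divide flip: exp_of_nat_mult exp_double)
      then have "q \<le> exp (2 / (real n)\<^sup>2)"
        by (rule power2_le_imp_le) simp
      then have "q ^ m \<le> exp (2 / (real n)\<^sup>2) ^ m"
        by (rule power_mono) (simp add: q_def)
      also have "\<dots> = exp (2 * (real m / (real n)\<^sup>2))"
        by (simp flip: exp_of_nat_mult)
      also have "\<dots> \<le> exp 2"
      proof -
        have "real m \<le> (real n)\<^sup>2"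
          using m by (metis of_nat_le_iff of_nat_power)
        then have "real m / (real n)\<^sup>2 \<le> 1"
          by (intro divide_le_eq_1_pos[THEN iffD2]) (use n in auto)
        then show ?thesis by (simp only: exp_le_cancel_iff)
      qed
      finally show ?thesis .
    qed
    have qpos: "0 < q" by (simp add: q_def add_pos_nonneg)
    have "\<exists>\<tau> \<ge> real m / (real n * L). \<forall>w. norm (G \<tau> w) \<le> N\<^sub>0 * q ^ m * norm w" if "m \<le> n\<^sup>2" for m
      using that
    proof (induction m)
      case 0
      then show ?case using start by (intro exI[of _ 0]) simp
    next
      case (Suc m)
      then obtain \<tau> where \<tau>: "real m / (real n * L) \<le> \<tau>" "\<And>w. norm (G \<tau> w) \<le> N\<^sub>0 * q ^ m * norm w"
        by auto
      have N: "0 < N\<^sub>0 * q ^ m" using N\<^sub>0 qpos by simp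
      have "N\<^sub>0 * q ^ m \<le> L"
        using q[of m] N\<^sub>0 Suc.prems by (simp add: L_def)
      then have "1 / (real n * L) \<le> (1 / real n) / (N\<^sub>0 * q ^ m)"
        using N n L by (simp add: field_simps)
      with \<tau>(1) have "real (Suc m) / (real n * L) \<le> \<tau> + (1 / real n) / (N\<^sub>0 * q ^ m)"
        by (simp add: add_divide_distrib)
      moreover have "norm (G (\<tau> + (1 / real n) / (N\<^sub>0 * q ^ m)) w) \<le> N\<^sub>0 * q ^ Suc m * norm w" for w
        using step[OF N \<tau>(2), of "1 / real n" w] unfolding q_def[symmetric]
        by (simp add: mult.assoc mult.commute mult.left_commute)
      ultimately show ?case by blast
    qed
    from this[of "n\<^sup>2"] obtain \<tau> where \<tau>: "real (n\<^sup>2) / (real n * L) \<le> \<tau>"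
      "\<And>w. norm (G \<tau> w) \<le> N\<^sub>0 * q ^ n\<^sup>2 * norm w"
      by auto
    have "real n / L \<le> \<tau>" using \<tau>(1) n by (simp add: power2_eq_square)
    then have "real n / L * norm (y u) \<le> \<tau> * norm (y u)"
      by (intro mult_right_mono) auto
    also have "\<dots> \<le> \<bar>\<tau>\<bar> * norm (y u)" by (intro mult_right_mono) auto
    also have "\<dots> \<le> norm (G \<tau> (u, 0))"
      using norm_fst_le[of "- \<tau> *\<^sub>R y u" "c\<^sub>2 u"] by (simp add: G_def)
    also have "\<dots> \<le> N\<^sub>0 * q ^ n\<^sup>2 * norm u"
      using \<tau>(2)[of "(u, 0)"] by (simp add: norm_Pair)
    also have "\<dots> \<le> L * norm u"
      using q[of "n\<^sup>2"] N\<^sub>0 by (intro mult_right_mono) (auto simp: L_def)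
    finally show ?thesis using L by (simp add: field_simps)
  qed
  have "y u = 0" for u
  proof (rule ccontr)
    assume "y u \<noteq> 0"
    then obtain n where n: "L * L * norm u < real n * norm (y u)"
      using reals_Archimedean3[of "norm (y u)"] by auto
    have "0 \<le> L * L * norm u" by simp
    with n have "0 < n" by (cases n) auto
    from bound[OF this, of u] n show False by simp
  qed
  then have "y = 0" by (auto intro: blinfun_eqI)
  then show ?thesis by (simp add: y_def z_def)
qed

section \<open>The image of the identity\<close>

text \<open>Let \<open>g = e (1 - e)\<close>. Since \<open>1 - e\<close> is in the kernel, so are \<open>g\<close> and \<open>g e g = e\<^sup>2 g - e\<^sup>3 g\<close>; but \<open>g e g\<close> is
  also in the range, hence zero. As everything commutes and is selfadjoint, first \<open>e g = 0\<close> and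
  then \<open>g\<^sup>2 = (1 - e) e g = 0\<close>.\<close>

lemma e_idempotent: "e o\<^sub>L e = e"
proof -
  define f where "f = id_blinfun - e"
  define g where "g = e o\<^sub>L f"
  have f: "f \<in> A" "P f = 0"
    by (auto simp: f_def P_diff A_intros e_in P_e) (simp add: e_def)
  have g: "g \<in> A" "P g = 0"
    by (auto simp: g_def A_intros e_in f P_e intro!: P_range_times_kernel)
  have comm: "f (e u) = e (f u)" for u
    by (simp add: f_def blinfun.bilinear_simps)
  have fself: "inner (f u) v = inner u (f v)" for u v
    by (simp add: f_def blinfun.bilinear_simps inner_diff e_selfadjoint)
  have gself: "inner (g u) v = inner u (g v)" for u v
    by (simp add: g_def fself e_selfadjoint comm)
  have geg: "g o\<^sub>L e o\<^sub>L g = (e o\<^sub>L (e o\<^sub>L g)) - (e o\<^sub>L (e o\<^sub>L (e o\<^sub>L g)))"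
    proof (rule blinfun_eqI)
    fix u
    have "(g o\<^sub>L e o\<^sub>L g) u = f (e (e (g u)))"
      by (simp add: g_def comm)
    then show "blinfun_apply (g o\<^sub>L e o\<^sub>L g) u
        = blinfun_apply ((e o\<^sub>L (e o\<^sub>L g)) - (e o\<^sub>L (e o\<^sub>L (e o\<^sub>L g)))) u"
      by (simp add: f_def blinfun.bilinear_simps)
  qed
  have "P (g o\<^sub>L e o\<^sub>L g) = g o\<^sub>L e o\<^sub>L g"
    by (intro kernel_middle_kernel e_in P_e e_selfadjoint e_contraction g)
  moreover have "P (g o\<^sub>L e o\<^sub>L g) = 0"
    unfolding geg by (simp add: P_diff P_range_times_kernel A_intros e_in P_e g)
  ultimately have geg0: "g o\<^sub>L e o\<^sub>L g = 0" by simp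
  have "e o\<^sub>L g = 0"
  proof (rule selfadjoint_square_zero)
    show "inner ((e o\<^sub>L g) u) v = inner u ((e o\<^sub>L g) v)" for u v
      by (simp add: g_def gself fself e_selfadjoint comm)
    show "(e o\<^sub>L g) o\<^sub>L (e o\<^sub>L g) = 0"
    proof -
      have "(e o\<^sub>L g) o\<^sub>L (e o\<^sub>L g) = e o\<^sub>L (g o\<^sub>L e o\<^sub>L g)"
        by (simp add: blinfun_compose_assoc)
      then show ?thesis by (simp add: geg0)
    qed
  qed
  then have eg: "e (g u) = 0" for u
    by (metis blinfun_apply_blinfun_compose zero_blinfun.rep_eq)
  have "g = 0"
  proof (rule selfadjoint_square_zero[OF gself])
    show "g o\<^sub>L g = 0"
    proof (rule blinfun_eqI)
      fix u
      have "(g o\<^sub>L g) u = f (e (g u))" by (simp add: g_def comm)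
      then show "blinfun_apply (g o\<^sub>L g) u = blinfun_apply 0 u" by (simp add: eg blinfun.zero_right)
    qed
  qed
  show ?thesis
  proof (rule blinfun_eqI)
    fix u
    have "g u = e u - e (e u)" by (simp add: g_def f_def blinfun.bilinear_simps)
    then show "blinfun_apply (e o\<^sub>L e) u = blinfun_apply e u" by (simp add: \<open>g = 0\<close>)
  qed
qed

text \<open>The adjoint of \<open>x\<close> vanishes on the kernel of \<open>e\<close>, which is the range of \<open>1 - e\<close>; therefore
  \<open>(1 - e) x = 0\<close>.\<close>

lemma e_left_identity:
  assumes x: "x \<in> A" "P x = x"
  shows "e o\<^sub>L x = x"
proof (rule blinfun_eqI)
  fix u
  obtain S :: "'h \<Rightarrow>\<^sub>L 'h" where S: "\<And>u v. inner (x u) v = inner u (S v)"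
    using adjoint_exists by metis
  have "e (e v) = e v" for v
    using e_idempotent by (metis blinfun_apply_blinfun_compose)
  then have "S (v - e v) = 0" for v
    using norm_adjoint_le_unit_image[OF x S, of "v - e v"] by (simp add: blinfun.diff_right)
  then have "inner (x u - e (x u)) v = 0" for v
    using S[of u "v - e v"] by (simp add: inner_diff e_selfadjoint)
  then have "x u - e (x u) = 0"
    by (metis inner_eq_zero_iff)
  then show "blinfun_apply (e o\<^sub>L x) u = blinfun_apply x u" by simp
qed

section \<open>The kernel inside the generated algebra\<close>

abbreviation D where "D \<equiv> closed_algebra_generated (P ` A)"

lemma algebra_D: "algebra_of_operators D"
  and range_subset_D: "P ` A \<subseteq> D"
proof -
  have "A \<in> {B. algebra_of_operators B \<and> closed B \<and> P ` A \<subseteq> B}"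
    using alg P_in by (auto simp: unital_operator_algebra_def)
  then have "D \<subseteq> A"
    unfolding closed_algebra_generated_def by (rule Inter_lower)
  then have "D \<subseteq> complex_linear_ops"
    using A_linear by simp
  then show "algebra_of_operators D"
    by (simp add: closed_algebra_generated_def algebra_of_operators_def operator_subspace_def)
  show "P ` A \<subseteq> D"
    by (auto simp: closed_algebra_generated_def)
qed

text \<open>These properties hold for elements of \<open>P(A)\<close> and define a closed algebra, by continuity of \<open>P\<close>.\<close>

lemma generated_algebra_inherits:
  assumes "d \<in> D"
  shows "d \<in> A" "e o\<^sub>L d = d" "c \<in> A \<Longrightarrow> P c = 0 \<Longrightarrow> P (d o\<^sub>L c) = 0"
proof -
  define B where "B = {d \<in> A. e o\<^sub>L d = d \<and> (\<forall>c\<in>A. P c = 0 \<longrightarrow> P (d o\<^sub>L c) = 0)}"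
  note comp = bounded_bilinear_blinfun_compose
  have "operator_subspace B"
    unfolding operator_subspace_def
  proof (intro conjI ballI allI)
    show "B \<subseteq> complex_linear_ops" using A_linear by (auto simp: B_def)
    show "0 \<in> B" by (auto simp: B_def A_zero P_zero)
    show "x + y \<in> B" if "x \<in> B" "y \<in> B" for x y
      using that by (simp add: B_def A_add A_mult P_add bounded_bilinear.add_left[OF comp]
          bounded_bilinear.add_right[OF comp])
    show "s *\<^sub>O x \<in> B" if "x \<in> B" for s x
    proof -
      have "(s *\<^sub>O x) o\<^sub>L c = s *\<^sub>O (x o\<^sub>L c)" for c
        by (rule blinfun_eqI) (simp add: scaleC_op.rep_eq)
      moreover have "e o\<^sub>L (s *\<^sub>O x) = s *\<^sub>O (e o\<^sub>L x)"
        by (rule blinfun_eqI) (simp add: scaleC_op.rep_eq op_scaleC[OF e_in])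
      moreover have "s *\<^sub>O 0 = (0 :: 'h \<Rightarrow>\<^sub>L 'h)"
        by (rule blinfun_eqI) (simp add: scaleC_op.rep_eq scaleC_zero)
      ultimately show ?thesis
        using that by (simp add: B_def A_scaleC A_mult P_scaleC)
    qed
  qed
  moreover have "x o\<^sub>L y \<in> B" if "x \<in> B" "y \<in> B" for x y
  proof -
    have "e o\<^sub>L (x o\<^sub>L y) = x o\<^sub>L y"
      using that by (simp add: B_def flip: blinfun_compose_assoc)
    with that show ?thesis by (simp add: B_def A_mult blinfun_compose_assoc)
  qed
  moreover have "closed B"
    unfolding closed_sequential_limits
  proof (intro allI impI, elim conjE)
    fix X l assume X: "\<forall>n. X n \<in> B" "X \<longlonglongrightarrow> l"
    have l: "l \<in> A"
      using X A_closed unfolding closed_sequential_limits B_def by blast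
    have "(\<lambda>n. e o\<^sub>L X n) \<longlonglongrightarrow> (e o\<^sub>L l)"
      using X(2) by (intro bounded_bilinear.tendsto[OF comp] tendsto_const)
    moreover have "(\<lambda>n. e o\<^sub>L X n) = X"
      using X(1) by (auto simp: B_def)
    ultimately have "e o\<^sub>L l = l"
      using X(2) LIMSEQ_unique by metis
    moreover have "P (l o\<^sub>L c) = 0" if c: "c \<in> A" "P c = 0" for c
    proof -
      have "(\<lambda>n. norm ((l o\<^sub>L c) - (X n o\<^sub>L c))) \<longlonglongrightarrow> norm ((l o\<^sub>L c) - (l o\<^sub>L c))"
        using X(2) by (intro tendsto_intros bounded_bilinear.tendsto[OF comp])
      then have lim: "(\<lambda>n. norm ((l o\<^sub>L c) - (X n o\<^sub>L c))) \<longlonglongrightarrow> 0"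
        by (simp only: diff_self norm_zero)
      have "norm (P (l o\<^sub>L c)) \<le> norm ((l o\<^sub>L c) - (X n o\<^sub>L c))" for n
        using P_contractive[of "(l o\<^sub>L c) - (X n o\<^sub>L c)"] X(1) l c
        by (auto simp: B_def P_diff A_diff A_mult)
      with lim have "norm (P (l o\<^sub>L c)) \<le> 0"
        by (intro LIMSEQ_le_const[OF lim]) auto
      then show ?thesis by simp
    qed
    ultimately show "l \<in> B" using l by (simp add: B_def)
  qed
  moreover have "P ` A \<subseteq> B"
    by (auto simp: B_def P_in P_idem e_left_identity P_range_times_kernel)
  ultimately have "D \<subseteq> B"
    unfolding closed_algebra_generated_def algebra_of_operators_def by blast
  with assms show "d \<in> A" "e o\<^sub>L d = d" "c \<in> A \<Longrightarrow> P c = 0 \<Longrightarrow> P (d o\<^sub>L c) = 0"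
    by (auto simp: B_def)
qed

definition kernel_part where "kernel_part = {j \<in> D. P j = 0}"

lemma kernel_part_left_ideal: "d \<in> D \<Longrightarrow> j \<in> kernel_part \<Longrightarrow> d o\<^sub>L j \<in> kernel_part"
  using algebra_D generated_algebra_inherits by (auto simp: kernel_part_def algebra_of_operators_def)

text \<open>Inserting the left identity \<open>e\<close> turns \<open>i j\<close> into \<open>i e j\<close>, which is in the range of \<open>P\<close>; it is in the
  kernel because \<open>D\<close> maps the kernel into itself.\<close>

lemma kernel_part_square_zero:
  assumes "i \<in> kernel_part" "j \<in> kernel_part"
  shows "i o\<^sub>L j = 0"
proof -
  have i: "i \<in> D" "i \<in> A" "P i = 0" and j: "j \<in> D" "j \<in> A" "P j = 0"
    using assms generated_algebra_inherits by (auto simp: kernel_part_def)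
  have "i o\<^sub>L j = i o\<^sub>L e o\<^sub>L j"
    using generated_algebra_inherits(2)[OF j(1)] by (simp add: blinfun_compose_assoc)
  also have "\<dots> = P (i o\<^sub>L e o\<^sub>L j)"
    by (intro kernel_middle_kernel[symmetric] e_in P_e e_selfadjoint e_contraction i j)
  also have "\<dots> = P (i o\<^sub>L j)"
    using generated_algebra_inherits(2)[OF j(1)] by (simp add: blinfun_compose_assoc)
  also have "\<dots> = 0"
    by (rule generated_algebra_inherits(3)[OF i(1) j(2,3)])
  finally show ?thesis .
qed

text \<open>For \<open>x, y\<close> in the range, \<open>x y - P (x y)\<close> lies in \<open>D\<close> and in the kernel.\<close>

lemma range_subalgebra_if_kernel_part_trivial:
  assumes "kernel_part \<subseteq> {0}"
  shows "is_subalgebra (P ` A) A"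
proof -
  have fix_iff: "x \<in> P ` A \<longleftrightarrow> x \<in> A \<and> P x = x" for x
    by (auto simp: P_idem P_in intro: rev_image_eqI)
  have "x o\<^sub>L y \<in> P ` A" if xy: "x \<in> P ` A" "y \<in> P ` A" for x y
  proof -
    have D: "x \<in> D" "y \<in> D" using xy range_subset_D by auto
    have A: "x o\<^sub>L y \<in> A" using xy by (auto simp: fix_iff A_mult)
    have "(x o\<^sub>L y) - P (x o\<^sub>L y) \<in> D"
    proof -
      have "P (x o\<^sub>L y) \<in> D" using A range_subset_D by auto
      then have "(- 1) *\<^sub>O P (x o\<^sub>L y) \<in> D" "x o\<^sub>L y \<in> D"
        using algebra_D D by (auto simp: algebra_of_operators_def operator_subspace_def)
      then have "(x o\<^sub>L y) + (- 1) *\<^sub>O P (x o\<^sub>L y) \<in> D"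
        using algebra_D by (auto simp: algebra_of_operators_def operator_subspace_def)
      then show ?thesis
        by (simp flip: scaleR_op[of "- 1", simplified])
    qed
    then have "(x o\<^sub>L y) - P (x o\<^sub>L y) \<in> kernel_part"
      using A by (simp add: kernel_part_def P_diff P_idem P_in)
    with assms have "P (x o\<^sub>L y) = x o\<^sub>L y" by auto
    with A show ?thesis by (simp add: fix_iff)
  qed
  then show ?thesis
    using A_linear unfolding is_subalgebra_def algebra_of_operators_def operator_subspace_def
    by (auto simp: fix_iff A_intros P_zero P_add P_scaleC P_in subsetD[OF A_linear])
qed

end

theorem corollary4p4:
  fixes A :: "('h::complex_hilbert_space \<Rightarrow>\<^sub>L 'h) set"
    and P :: "('h \<Rightarrow>\<^sub>L 'h) \<Rightarrow> ('h \<Rightarrow>\<^sub>L 'h)"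
  assumes "unital_operator_algebra A"
    and "projection_on A P"
    and "completely_bicontractive A P"
    and "real_completely_positive A P"
  shows "((\<forall>x\<in>A. nilpotent_op x \<longrightarrow> x = 0) \<longrightarrow> is_subalgebra (P ` A) A) \<and>
    (semiprime_algebra (closed_algebra_generated (P ` A)) \<longrightarrow> is_subalgebra (P ` A) A)"
proof -
  interpret bicontractive_projection A P
    using assms by unfold_locales
  show ?thesis
  proof (intro conjI impI range_subalgebra_if_kernel_part_trivial subsetI)
    fix j assume nil: "\<forall>x\<in>A. nilpotent_op x \<longrightarrow> x = 0" and j: "j \<in> kernel_part"
    have "((o\<^sub>L) j ^^ 2) id_blinfun = 0"
      using kernel_part_square_zero[OF j j] by (simp add: numeral_2_eq_2 flip: blinfun_compose_assoc)
    then have "nilpotent_op j"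
      unfolding nilpotent_op_def by (intro exI[of _ 2]) simp
    moreover have "j \<in> A" using j generated_algebra_inherits(1) by (auto simp: kernel_part_def)
    ultimately show "j \<in> {0}" using nil by simp
  next
    fix j assume semiprime: "semiprime_algebra D" and j: "j \<in> kernel_part"
    have "kernel_part \<subseteq> {0}"
      by (rule left_square_zero_ideal_in_semiprime[OF algebra_D semiprime])
        (auto simp: kernel_part_left_ideal kernel_part_square_zero, simp add: kernel_part_def)
    with j show "j \<in> {0}" by blast
  qed
qed

end
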